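(* Let $r\geq 2$, let $H$ be an $(r+1)$-uniform hypergraph with at least one edge, and let $\mathcal{H}$ be a set of $r$-uniform hypergraphs such that $H(i)\in\mathcal{H}$ for each vertex $i\in V(H)$. Suppose that $F$ is an $r$-uniform hypergraph without isolated vertices. Then $K_1\ast F$ is a subhypergraph of $H$ if one of the following holds: (1) $\beta(H)>r^{-1}\,\mathrm{spex}_{\mathcal{H}}\left(\max_{i\in V(H)}|N(i)|,F\right)$. (2) $(r+1)|E(H)|>r^{-1}|V(H)|\,\rho(H^{(2)})\,\mathrm{spex}_{\mathcal{H}}\left(\max_{i\in V(H)}|N(i)|,F\right)$. (3) $\rho(H)>r^{-1}\Delta(H^{(2)})\,\mathrm{spex}_{\mathcal{H}}\left(\max_{i\in V(H)}|N(i)|,F\right)$.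
   Context: A (finite) hypergraph $H$ with vertex set $V(H)$ and edge set $E(H)$ is $k$-uniform if each edge consists of exactly $k$ distinct vertices; a graph is a $2$-uniform hypergraph. A hypergraph $H_0$ is a subhypergraph of $H$ if $V(H_0)\subseteq V(H)$ and $E(H_0)\subseteq E(H)$ (as usual, "$F$ is a subhypergraph of $H$" is understood up to isomorphism, and $H$ is $F$-free if it has no subhypergraph isomorphic to $F$). The adjacency tensor of a $k$-uniform hypergraph $H$ is the $k$-order $|V(H)|$-dimension tensor $\mathcal{A}_H=(a_{i_1\cdots i_k})$ with $a_{i_1\cdots i_k}=\frac{1}{(k-1)!}$ if $\{i_1,\ldots,i_k\}\in E(H)$ and $0$ otherwise. For an $m$-order $n$-dimension tensor $\mathcal{A}=(a_{i_1\cdots i_m})$ and $x\in\mathbb{C}^n$, $\mathcal{A}x^{m-1}\in\mathbb{C}^n$ is the vector with $i$-th component $\sum_{i_2,\ldots,i_m=1}^n a_{ii_2\cdots i_m}x_{i_2}\cdots x_{i_m}$. A number $\lambda\in\mathbb{C}$ is an eigenvalue of $\mathcal{A}$ if $\mathcal{A}x^{m-1}=\lambda x^{[m-1]}$ for some nonzero $x\in\mathbb{C}^n$, where $x^{[m-1]}=(x_1^{m-1},\ldots,x_n^{m-1})^\top$. The spectral radius of $\mathcal{A}$ is the largest modulus of its eigenvalues, and $\rho(H)$ is the spectral radius of $\mathcal{A}_H$ (for a graph, the spectral radius of its adjacency matrix). The 2-section graph $H^{(2)}$ of $H$ is the graph on $V(H)$ in which distinct $u,v$ are adjacent if and only if $\{u,v\}\subseteq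 e$ for some $e\in E(H)$; $\Delta(H^{(2)})$ is its maximum degree. The spectral radius ratio is $\beta(H)=\rho(H)/\rho(H^{(2)})$. For a vertex $u$ of an $(r+1)$-uniform hypergraph $H$, $N(u)$ is the set of neighbors of $u$ in $H^{(2)}$, and $H(u)$ is the $r$-uniform hypergraph with vertex set $N(u)$ and edge set $\{e\setminus\{u\}: u\in e\in E(H)\}$. For an $r$-uniform hypergraph $F$, $K_1\ast F$ is the $(r+1)$-uniform hypergraph with vertex set $V(F)\cup\{x\}$ (with $x\notin V(F)$ a new vertex) and edge set $\{\{x,u_1,\ldots,u_r\}:\{u_1,\ldots,u_r\}\in E(F)\}$. For a set $\mathcal{H}$ of $r$-uniform hypergraphs, $\mathrm{spex}_{\mathcal{H}}(n,F)$ is the maximum spectral radius of an $n$-vertex $F$-free hypergraph in $\mathcal{H}$.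
   Formalization: As stated this fails for some sets 𝓗 (e.g. 𝓗 the links of K_4^(3) plus two 3-edges sharing a vertex, F = K_4). Added assumption: for each vertex i, H(i) with isolated vertices added to reach max|N(j)| vertices also lies in 𝓗. *)

theory Defs
  imports Complex_Main
begin

datatype 'a hypergraph = Hypergraph (verts: "'a set") (edges: "'a set set")

definition uniform :: "nat \<Rightarrow> 'a hypergraph \<Rightarrow> bool" where
  "uniform k H \<longleftrightarrow> finite (verts H) \<and> (\<forall>e\<in>edges H. e \<subseteq> verts H \<and> card e = k)"

definition no_isolated :: "'a hypergraph \<Rightarrow> bool" where
  "no_isolated H \<longleftrightarrow> (\<forall>v\<in>verts H. \<exists>e\<in>edges H. v \<in> e)"

definition subhypergraph :: "'a hypergraph \<Rightarrow> 'a hypergraph \<Rightarrow> bool" where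
  "subhypergraph H0 H \<longleftrightarrow> verts H0 \<subseteq> verts H \<and> edges H0 \<subseteq> edges H"

definition isomorphic :: "'a hypergraph \<Rightarrow> 'b hypergraph \<Rightarrow> bool" where
  "isomorphic F G \<longleftrightarrow>
     (\<exists>f. bij_betw f (verts F) (verts G) \<and> (\<lambda>e. f ` e) ` edges F = edges G)"

definition contains :: "'a hypergraph \<Rightarrow> 'b hypergraph \<Rightarrow> bool" where
  "contains H F \<longleftrightarrow> (\<exists>H0. subhypergraph H0 H \<and> isomorphic F H0)"

text \<open>
  A tensor of order \<open>m\<close> whose dimension is the cardinality of a finite index set \<open>I\<close> is a
  function on index lists; only lists of length \<open>m\<close> over \<open>I\<close> matter. Vectors are functions of
  which only the values on \<open>I\<close> matter.
\<close>

definition tensor_apply ::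
  "'a set \<Rightarrow> nat \<Rightarrow> ('a list \<Rightarrow> complex) \<Rightarrow> ('a \<Rightarrow> complex) \<Rightarrow> 'a \<Rightarrow> complex" where
  "tensor_apply I m A x i =
     (\<Sum>js | set js \<subseteq> I \<and> length js = m - 1. A (i # js) * prod_list (map x js))"

definition tensor_eigenvalue ::
  "'a set \<Rightarrow> nat \<Rightarrow> ('a list \<Rightarrow> complex) \<Rightarrow> complex \<Rightarrow> bool" where
  "tensor_eigenvalue I m A l \<longleftrightarrow>
     (\<exists>x. (\<exists>i\<in>I. x i \<noteq> 0) \<and> (\<forall>i\<in>I. tensor_apply I m A x i = l * x i ^ (m - 1)))"

text \<open>
  By homogeneity, eigenvectors can be normalised, so the set of eigenvalues is compact and,
  when it is nonempty, the supremum is attained. \<open>Sup\<close> rather than \<open>Max\<close> is used because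
  \<open>Max\<close> is meaningful only once the set is known to be finite.
\<close>

definition tensor_spectral_radius :: "'a set \<Rightarrow> nat \<Rightarrow> ('a list \<Rightarrow> complex) \<Rightarrow> real" where
  "tensor_spectral_radius I m A = Sup (cmod ` {l. tensor_eigenvalue I m A l})"

definition adjacency_tensor :: "nat \<Rightarrow> 'a hypergraph \<Rightarrow> 'a list \<Rightarrow> complex" where
  "adjacency_tensor k H js = (if set js \<in> edges H then 1 / fact (k - 1) else 0)"

text \<open>
  The spectral radius of a \<open>k\<close>-uniform hypergraph. For \<open>k = 2\<close> the tensor is the 0/1 adjacency
  matrix and its eigenvalues are the usual matrix eigenvalues.
\<close>

definition spectral_radius :: "nat \<Rightarrow> 'a hypergraph \<Rightarrow> real" where
  "spectral_radius k H = tensor_spectral_radius (verts H) k (adjacency_tensor k H)"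

definition two_section :: "'a hypergraph \<Rightarrow> 'a hypergraph" where
  "two_section H =
     Hypergraph (verts H) {{u, v} | u v. u \<noteq> v \<and> (\<exists>e\<in>edges H. {u, v} \<subseteq> e)}"

definition graph_neighbors :: "'a hypergraph \<Rightarrow> 'a \<Rightarrow> 'a set" where
  "graph_neighbors G u = {v. {u, v} \<in> edges G}"

definition max_degree :: "'a hypergraph \<Rightarrow> nat" where
  "max_degree G = (MAX v\<in>verts G. card (graph_neighbors G v))"

definition neighbors :: "'a hypergraph \<Rightarrow> 'a \<Rightarrow> 'a set" where
  "neighbors H u = graph_neighbors (two_section H) u"

definition spectral_radius_ratio :: "nat \<Rightarrow> 'a hypergraph \<Rightarrow> real" where
  "spectral_radius_ratio k H = spectral_radius k H / spectral_radius 2 (two_section H)"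

definition link :: "'a hypergraph \<Rightarrow> 'a \<Rightarrow> 'a hypergraph" where
  "link H u = Hypergraph (neighbors H u) {e - {u} | e. e \<in> edges H \<and> u \<in> e}"

text \<open>The hypergraph \<open>K\<^sub>1 * F\<close>, with \<open>None\<close> as the new vertex.\<close>

definition cone :: "'a hypergraph \<Rightarrow> 'a option hypergraph" where
  "cone F = Hypergraph (insert None (Some ` verts F)) ((\<lambda>e. insert None (Some ` e)) ` edges F)"

text \<open>
  The maximum ranges over a finite set of reals even if \<open>\<H>\<close> is infinite, since there are only
  finitely many \<open>r\<close>-uniform hypergraphs on \<open>n\<close> vertices up to isomorphism.
\<close>

definition spex :: "nat \<Rightarrow> 'a hypergraph set \<Rightarrow> nat \<Rightarrow> 'b hypergraph \<Rightarrow> real" where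
  "spex r \<H> n F =
     Max {spectral_radius r G | G. G \<in> \<H> \<and> card (verts G) = n \<and> \<not> contains G F}"

text \<open>
  Adding isolated vertices is needed to compare links with different numbers of vertices inside
  a class \<open>\<H>\<close>: with no condition on \<open>\<H>\<close>, the function \<open>spex r \<H> n F\<close> need not be monotone in
  \<open>n\<close>. For instance, let \<open>H\<close> be the disjoint union of the complete 3-uniform hypergraph on four
  vertices and two 3-edges sharing one vertex, let \<open>\<H>\<close> consist of the links of \<open>H\<close> and let \<open>F\<close>
  be the complete graph on four vertices. The four-vertex members of \<open>\<H>\<close> are perfect matchings,
  with spectral radius 1, although \<open>\<H>\<close> also has triangles, with spectral radius 2; \<open>H\<close> has
  spectral radius ratio 1 and does not contain \<open>cone F\<close>.
\<close>

definition add_isolated :: "'a set \<Rightarrow> 'a hypergraph \<Rightarrow> 'a hypergraph" where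
  "add_isolated W G = Hypergraph (verts G \<union> W) (edges G)"

end

theory Submission
  imports Defs "HOL-Analysis.Function_Topology" "HOL-Combinatorics.Multiset_Permutations"
begin

text \<open>
  Suppose \<open>H\<close> does not contain the cone over \<open>F\<close>. Then no link \<open>H(i)\<close> contains \<open>F\<close>, so with
  \<open>s\<close> the value of \<open>spex\<close>, the spectral radius of every link is at most \<open>s\<close>. If \<open>x\<close> is an
  eigenvector of \<open>H\<close> for \<open>l\<close>, the \<open>i\<close>-th eigenequation gives that \<open>|l| |x\<^sub>i|\<^sup>r\<close> is at most the
  edge polynomial of \<open>H(i)\<close> at \<open>|x|\<close>, which by the variational bound for the spectral radius is at
  most \<open>s/r\<close> times the sum of \<open>|x\<^sub>j|\<^sup>r\<close> over the neighbours \<open>j\<close> of \<open>i\<close>. Thus the vector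
  \<open>z\<^sub>i = |x\<^sub>i|\<^sup>r\<close> satisfies \<open>r |l| z \<le> s A z\<close> for the adjacency matrix \<open>A\<close> of the 2-section.
  Pairing with \<open>z\<close> refutes (1), and (2) follows since the average degree is at most the spectral
  radius; a maximal coordinate of \<open>z\<close> refutes (3).
\<close>

section \<open>Edge polynomial and eigenvalue equations\<close>

definition edge_form :: "'a hypergraph \<Rightarrow> ('a \<Rightarrow> 'c::comm_ring_1) \<Rightarrow> 'c" where
  "edge_form G x = (\<Sum>e\<in>edges G. \<Prod>j\<in>e. x j)"

text \<open>The formal partial derivative of the edge polynomial in the variable \<open>i\<close>.
  The coefficient ring is left general because eigenvectors are complex while the variational
  argument works with real vectors.\<close>

definition edge_form_deriv :: "'a hypergraph \<Rightarrow> ('a \<Rightarrow> 'c::comm_ring_1) \<Rightarrow> 'a \<Rightarrow> 'c" where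
  "edge_form_deriv G x i = (\<Sum>e | e \<in> edges G \<and> i \<in> e. \<Prod>j\<in>e - {i}. x j)"

lemma uniform_finite_edges: "uniform k G \<Longrightarrow> finite (edges G)"
  unfolding uniform_def by (meson Pow_iff finite_Pow_iff finite_subset subsetI)

lemma uniform_finite_edge: "uniform k G \<Longrightarrow> e \<in> edges G \<Longrightarrow> finite e"
  unfolding uniform_def by (meson finite_subset)

text \<open>The \<open>k - 1\<close> vertices other than \<open>i\<close> can be listed in
  \<open>(k - 1)!\<close> orders, all with the same product, so the factor
  \<open>1 / fact (k - 1)\<close> of the adjacency tensor cancels exactly.\<close>

lemma sum_lists_spanning_edge:
  fixes x :: "'a \<Rightarrow> complex"
  assumes "uniform k G" "k \<ge> 1" "e \<in> edges G" "i \<in> e"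
  shows "(\<Sum>js\<in>permutations_of_set (e - {i}). prod_list (map x js) / fact (k - 1)) = (\<Prod>j\<in>e - {i}. x j)"
proof -
  have fin: "finite (e - {i})" and card: "card (e - {i}) = k - 1"
    using assms uniform_finite_edge[OF assms(1,3)] by (auto simp: uniform_def)
  have "(\<Sum>js\<in>permutations_of_set (e - {i}). prod_list (map x js) / fact (k - 1))
      = (\<Sum>js\<in>permutations_of_set (e - {i}). (\<Prod>j\<in>e - {i}. x j) / fact (k - 1))"
    by (intro sum.cong refl)
       (auto simp: permutations_of_set_def prod.distinct_set_conv_list[symmetric])
  also have "\<dots> = (\<Prod>j\<in>e - {i}. x j)"
    using fin card by simp
  finally show ?thesis .
qed

lemma tensor_apply_adjacency:
  assumes "uniform k G" "k \<ge> 1" "i \<in> verts G"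
  shows "tensor_apply (verts G) k (adjacency_tensor k G) x i = edge_form_deriv G x i"
proof -
  let ?L = "{js. set js \<subseteq> verts G \<and> length js = k - 1}"
  let ?E = "{e. e \<in> edges G \<and> i \<in> e}"
  let ?g = "\<lambda>js. prod_list (map x js) / fact (k - 1)"
  have finV: "finite (verts G)" using assms by (auto simp: uniform_def)
  have finL: "finite ?L" using finite_lists_length_eq[OF finV] by simp
  have finE: "finite ?E" using uniform_finite_edges[OF assms(1)] by simp
  \<comment> \<open>A list of \<open>k\<close> vertices whose entries form an edge has no
    repetition, since an edge has \<open>k\<close> elements. The lists contributing to the tensor
    thus split into orderings of \<open>e - {i}\<close>, one class per edge through
    \<open>i\<close>.\<close>
  have eq: "{js\<in>?L. set (i # js) \<in> edges G} = (\<Union>e\<in>?E. permutations_of_set (e - {i}))"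
  proof (intro equalityI subsetI)
    fix js assume "js \<in> {js\<in>?L. set (i # js) \<in> edges G}"
    then have js: "length js = k - 1" "set (i # js) \<in> edges G" by auto
    then have c: "card (set (i # js)) = length (i # js)"
      using assms by (auto simp: uniform_def)
    then have "distinct (i # js)" by (rule card_distinct)
    then have "js \<in> permutations_of_set (set (i # js) - {i})"
      by (auto simp: permutations_of_set_def)
    then show "js \<in> (\<Union>e\<in>?E. permutations_of_set (e - {i}))" using js by force
  next
    fix js assume "js \<in> (\<Union>e\<in>?E. permutations_of_set (e - {i}))"
    then obtain e where e: "e \<in> edges G" "i \<in> e" "set js = e - {i}" "distinct js"
      by (auto simp: permutations_of_set_def)
    then have "set (i # js) = e" by auto
    moreover have "length js = k - 1"
      using e assms distinct_card[of js] uniform_finite_edge[OF assms(1), of e]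
      by (auto simp: uniform_def)
    moreover have "set js \<subseteq> verts G" using e assms by (auto simp: uniform_def)
    ultimately show "js \<in> {js\<in>?L. set (i # js) \<in> edges G}" using e by auto
  qed
  have "tensor_apply (verts G) k (adjacency_tensor k G) x i
      = (\<Sum>js\<in>?L. if set (i # js) \<in> edges G then ?g js else 0)"
    unfolding tensor_apply_def adjacency_tensor_def by (intro sum.cong) auto
  also have "\<dots> = (\<Sum>js\<in>{js\<in>?L. set (i # js) \<in> edges G}. ?g js)"
    by (rule sum.inter_filter[OF finL, symmetric])
  also have "\<dots> = (\<Sum>e\<in>?E. \<Sum>js\<in>permutations_of_set (e - {i}). ?g js)"
    unfolding eq using finE
    by (intro sum.UNION_disjoint) (auto dest: permutations_of_setD)
  also have "\<dots> = edge_form_deriv G x i"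
    unfolding edge_form_deriv_def
    by (intro sum.cong refl sum_lists_spanning_edge[OF assms(1,2)]) auto
  finally show ?thesis .
qed

lemma tensor_eigenvalue_adjacency:
  assumes "uniform k G" "k \<ge> 1"
  shows "tensor_eigenvalue (verts G) k (adjacency_tensor k G) l \<longleftrightarrow>
    (\<exists>x. (\<exists>i\<in>verts G. x i \<noteq> 0) \<and> (\<forall>i\<in>verts G. edge_form_deriv G x i = l * x i ^ (k - 1)))"
  unfolding tensor_eigenvalue_def using tensor_apply_adjacency[OF assms] by auto

section \<open>Boundedness of the eigenvalues\<close>

lemma cmod_eigenvector_inequality:
  assumes "edge_form_deriv G x i = l * x i ^ p"
  shows "cmod l * cmod (x i) ^ p \<le> edge_form_deriv G (\<lambda>j. cmod (x j)) i"
proof -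
  have "cmod l * cmod (x i) ^ p = cmod (edge_form_deriv G x i)"
    by (simp add: assms norm_mult norm_power)
  also have "\<dots> \<le> edge_form_deriv G (\<lambda>j. cmod (x j)) i"
    unfolding edge_form_deriv_def prod_norm by (rule norm_sum)
  finally show ?thesis .
qed

lemma maximal_coordinate:
  fixes y :: "'a \<Rightarrow> real"
  assumes "finite V" "\<exists>i\<in>V. y i \<noteq> 0" "\<And>i. y i \<ge> 0"
  obtains m where "m \<in> V" "y m > 0" "\<And>j. j \<in> V \<Longrightarrow> y j \<le> y m"
proof -
  have ne: "y ` V \<noteq> {}" using assms by auto
  obtain m where m: "m \<in> V" "y m = Max (y ` V)"
    using Max_in[OF finite_imageI[OF assms(1)] ne] by force
  have le: "y j \<le> y m" if "j \<in> V" for j using that m assms by simp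
  obtain i where "i \<in> V" "y i > 0" using assms by (metis order_le_less)
  then have "y m > 0" using le[of i] by simp
  with m le that show ?thesis by blast
qed

text \<open>At a coordinate \<open>m\<close> where an eigenvector has largest modulus, each edge
  through \<open>m\<close> contributes at most \<open>cmod (x m) ^ (k - 1)\<close>, so the number of
  edges bounds every eigenvalue. This makes the \<open>Sup\<close> in the spectral radius an upper
  bound.\<close>

lemma bdd_above_eigenvalues:
  assumes "uniform k G" "k \<ge> 1"
  shows "bdd_above (cmod ` {l. tensor_eigenvalue (verts G) k (adjacency_tensor k G) l})"
proof (rule bdd_aboveI2)
  fix l assume "l \<in> {l. tensor_eigenvalue (verts G) k (adjacency_tensor k G) l}"
  then obtain x where x: "\<exists>i\<in>verts G. x i \<noteq> 0"
    "\<And>i. i \<in> verts G \<Longrightarrow> edge_form_deriv G x i = l * x i ^ (k - 1)"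
    using tensor_eigenvalue_adjacency[OF assms] by auto
  have "finite (verts G)" using assms by (auto simp: uniform_def)
  then obtain m where m: "m \<in> verts G" "cmod (x m) > 0"
    "\<And>j. j \<in> verts G \<Longrightarrow> cmod (x j) \<le> cmod (x m)"
    using maximal_coordinate[of "verts G" "\<lambda>j. cmod (x j)"] x(1) by auto
  have "cmod l * cmod (x m) ^ (k - 1) \<le> edge_form_deriv G (\<lambda>j. cmod (x j)) m"
    by (rule cmod_eigenvector_inequality) (rule x(2)[OF m(1)])
  also have "\<dots> \<le> (\<Sum>e | e \<in> edges G \<and> m \<in> e. cmod (x m) ^ (k - 1))"
    unfolding edge_form_deriv_def
  proof (rule sum_mono)
    fix e assume e: "e \<in> {e. e \<in> edges G \<and> m \<in> e}"
    then have "(\<Prod>j\<in>e - {m}. cmod (x j)) \<le> (\<Prod>j\<in>e - {m}. cmod (x m))"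
      using m(3) assms(1) by (intro prod_mono) (auto simp: uniform_def)
    also have "\<dots> = cmod (x m) ^ (k - 1)"
      using e assms(1) uniform_finite_edge[OF assms(1), of e] by (auto simp: uniform_def)
    finally show "(\<Prod>j\<in>e - {m}. cmod (x j)) \<le> cmod (x m) ^ (k - 1)" .
  qed
  also have "\<dots> \<le> real (card (edges G)) * cmod (x m) ^ (k - 1)"
    using uniform_finite_edges[OF assms(1)]
    by (auto intro!: mult_right_mono card_mono)
  finally show "cmod l \<le> real (card (edges G))" using m(2) by simp
qed

lemma eigenvalue_le_spectral_radius:
  assumes "uniform k G" "k \<ge> 1" "tensor_eigenvalue (verts G) k (adjacency_tensor k G) l"
  shows "cmod l \<le> spectral_radius k G"
  unfolding spectral_radius_def tensor_spectral_radius_def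
  by (intro cSup_upper bdd_above_eigenvalues[OF assms(1,2)]) (use assms(3) in auto)

section \<open>The variational bound for the spectral radius\<close>

lemma edge_form_upd:
  assumes "uniform k G"
  shows "edge_form G (y(i := t)) =
    t * edge_form_deriv G y i + (\<Sum>e | e \<in> edges G \<and> i \<notin> e. \<Prod>j\<in>e. y j)"
proof -
  note fin = uniform_finite_edges[OF assms]
  have "edge_form G (y(i := t)) =
      (\<Sum>e | e \<in> edges G \<and> i \<in> e. \<Prod>j\<in>e. (y(i := t)) j)
      + (\<Sum>e | e \<in> edges G \<and> i \<notin> e. \<Prod>j\<in>e. (y(i := t)) j)"
    unfolding edge_form_def using fin
    by (subst sum.union_disjoint[symmetric]) (auto intro!: sum.cong)
  also have "(\<Sum>e | e \<in> edges G \<and> i \<in> e. \<Prod>j\<in>e. (y(i := t)) j)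
      = t * edge_form_deriv G y i"
    unfolding edge_form_deriv_def sum_distrib_left
  proof (rule sum.cong)
    fix e assume e: "e \<in> {e. e \<in> edges G \<and> i \<in> e}"
    then have "finite e" using uniform_finite_edge[OF assms] by auto
    then have "(\<Prod>j\<in>e. (y(i := t)) j) = t * (\<Prod>j\<in>e - {i}. (y(i := t)) j)"
      using e by (subst prod.remove[of e i]) auto
    also have "(\<Prod>j\<in>e - {i}. (y(i := t)) j) = (\<Prod>j\<in>e - {i}. y j)"
      by (intro prod.cong) auto
    finally show "(\<Prod>j\<in>e. (y(i := t)) j) = t * (\<Prod>j\<in>e - {i}. y j)" .
  qed simp
  also have "(\<Sum>e | e \<in> edges G \<and> i \<notin> e. \<Prod>j\<in>e. (y(i := t)) j)
      = (\<Sum>e | e \<in> edges G \<and> i \<notin> e. \<Prod>j\<in>e. y j)"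
    by (intro sum.cong prod.cong) auto
  finally show ?thesis .
qed

lemma edge_form_scale:
  assumes "uniform k G"
  shows "edge_form G (\<lambda>j. c * y j) = c ^ k * edge_form G y"
  unfolding edge_form_def sum_distrib_left using assms
  by (intro sum.cong refl) (auto simp: uniform_def prod.distrib)

text \<open>Multiplying by \<open>y i\<close> restores the full monomial of each edge through
  \<open>i\<close>, and every edge is met once for each of its \<open>k\<close> vertices.\<close>

lemma euler_identity:
  assumes "uniform k G"
  shows "(\<Sum>i\<in>verts G. y i * edge_form_deriv G y i) = of_nat k * edge_form G y"
proof -
  have finV: "finite (verts G)" using assms by (auto simp: uniform_def)
  have "(\<Sum>i\<in>verts G. y i * edge_form_deriv G y i)
      = (\<Sum>i\<in>verts G. \<Sum>e | e \<in> edges G \<and> i \<in> e. \<Prod>j\<in>e. y j)"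
    unfolding edge_form_deriv_def sum_distrib_left
    using uniform_finite_edge[OF assms]
    by (intro sum.cong refl) (auto simp: prod.remove)
  also have "\<dots> = (\<Sum>e\<in>edges G. \<Sum>i | i \<in> verts G \<and> i \<in> e. \<Prod>j\<in>e. y j)"
    by (rule sum.swap_restrict[OF finV uniform_finite_edges[OF assms]])
  also have "\<dots> = (\<Sum>e\<in>edges G. of_nat k * (\<Prod>j\<in>e. y j))"
  proof (rule sum.cong)
    fix e assume "e \<in> edges G"
    then have "{i. i \<in> verts G \<and> i \<in> e} = e" "card e = k" using assms by (auto simp: uniform_def)
    then show "(\<Sum>i | i \<in> verts G \<and> i \<in> e. \<Prod>j\<in>e. y j) = of_nat k * (\<Prod>j\<in>e. y j)" by simp
  qed simp
  finally show ?thesis by (simp add: edge_form_def sum_distrib_left)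
qed

text \<open>
  The optimality condition in one coordinate, including the boundary \<open>a = 0\<close> of the nonnegative
  orthant: there \<open>k \<ge> 2\<close> makes the power term negligible against the linear one.
\<close>
lemma minimum_power_minus_linear:
  fixes a M D :: real
  assumes "k \<ge> 2" "a \<ge> 0" "D \<ge> 0"
    and min: "\<And>t. t \<ge> 0 \<Longrightarrow> M * a ^ k - real k * D * a \<le> M * t ^ k - real k * D * t"
  shows "D = M * a ^ (k - 1)"
proof (cases "a = 0")
  case False
  let ?h = "\<lambda>t. M * t ^ k - real k * D * t"
  have d: "(?h has_real_derivative M * (real k * a ^ (k - 1)) - real k * D) (at a)"
    by (auto intro!: derivative_eq_intros)
  have "M * (real k * a ^ (k - 1)) - real k * D = 0"
  proof (rule DERIV_local_min[OF d])
    show "0 < a" using False assms by simp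
    \<comment> \<open>The radius \<open>a\<close> keeps \<open>t\<close> positive, where
      \<open>min\<close> applies.\<close>
    show "\<forall>t. \<bar>a - t\<bar> < a \<longrightarrow> ?h a \<le> ?h t" using min by auto
  qed
  then have "real k * (M * a ^ (k - 1) - D) = 0" by (simp add: algebra_simps)
  then show ?thesis using assms(1) by simp
next
  case True
  \<comment> \<open>At \<open>a = 0\<close> the minimum value is 0; dividing the inequality by
    \<open>t\<close> prepares the limit from the right.\<close>
  have le: "real k * D \<le> M * t ^ (k - 1)" if "t > 0" for t
  proof -
    have "real k * D * t \<le> M * t ^ (k - 1) * t"
      using min[of t] that True assms(1) power_minus_mult[of k t] by (simp add: mult.assoc zero_power)
    then show ?thesis using that by simp
  qed
  have "((\<lambda>t. M * t ^ (k - 1)) \<longlongrightarrow> M * 0 ^ (k - 1)) (at_right 0)"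
    by (intro tendsto_intros)
  moreover have "\<forall>\<^sub>F t in at_right 0. real k * D \<le> M * t ^ (k - 1)"
    using le eventually_at_right_less[of 0] by (auto elim: eventually_mono)
  ultimately have "real k * D \<le> M * 0 ^ (k - 1)"
    by (intro tendsto_lowerbound) auto
  then have "real k * D \<le> 0" using assms(1) by (simp add: zero_power)
  then have "D = 0" using assms(1,3) by (simp add: mult_le_0_iff)
  then show ?thesis using True assms(1) by simp
qed

text \<open>Vectors are functions on the whole type, so coordinates outside \<open>V\<close> are
  pinned to 0. The set is then a closed part of a product of compact sets, and Tychonoff's theorem
  applies.\<close>

lemma compact_nonneg_power_sphere:
  assumes "finite V" "k \<ge> 1"
  shows "compact {y. (\<forall>j. y j \<in> (if j \<in> V then {0..1} else {0})) \<and> (\<Sum>j\<in>V. y j ^ k) = (1::real)}"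
proof -
  let ?S = "\<lambda>j. if j \<in> V then {0..1} else {0::real}"
  have "compactin (product_topology (\<lambda>_. euclidean) UNIV) (PiE UNIV ?S)"
    unfolding compactin_PiE by auto
  then have "compact (PiE UNIV ?S)" by (simp add: euclidean_product_topology)
  moreover have "closed {y. (\<Sum>j\<in>V. y j ^ k) = (1::real)}"
    by (intro closed_Collect_eq continuous_intros continuous_on_product_coordinates)
  ultimately have "compact (PiE UNIV ?S \<inter> {y. (\<Sum>j\<in>V. y j ^ k) = (1::real)})"
    by (rule compact_Int_closed)
  moreover have "PiE UNIV ?S \<inter> {y. (\<Sum>j\<in>V. y j ^ k) = (1::real)} =
    {y. (\<forall>j. y j \<in> ?S j) \<and> (\<Sum>j\<in>V. y j ^ k) = 1}"
    by (auto simp: PiE_def Pi_def)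
  ultimately show ?thesis by simp
qed

text \<open>A maximizer exists on the compact power sphere, and \<open>M\<close> is \<open>k\<close>
  times the maximum. Both sides are homogeneous of degree \<open>k\<close>, which extends the
  inequality from the sphere to all nonnegative vectors.\<close>

lemma edge_form_maximizer:
  assumes "uniform k G" "k \<ge> 2" "verts G \<noteq> {}"
  obtains y M where "\<And>j. y j \<ge> 0" "\<exists>j\<in>verts G. y j \<noteq> 0"
    "real k * edge_form G y = M * (\<Sum>j\<in>verts G. y j ^ k)"
    "\<And>z. (\<And>j. z j \<ge> 0) \<Longrightarrow> real k * edge_form G z \<le> M * (\<Sum>j\<in>verts G. z j ^ k)"
proof -
  let ?V = "verts G"
  let ?K = "{y. (\<forall>j. y j \<in> (if j \<in> ?V then {0..1} else {0})) \<and> (\<Sum>j\<in>?V. y j ^ k) = (1::real)}"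
  have finV: "finite ?V" using assms by (auto simp: uniform_def)
  have comp: "compact ?K" using compact_nonneg_power_sphere[OF finV] assms by auto
  obtain v where v: "v \<in> ?V" using assms by auto
  have "(\<lambda>j. if j = v then 1 else 0) \<in> ?K"
    using v finV assms(2) by (auto simp: if_distrib[of "\<lambda>t. t ^ k"] power_0_left cong: if_cong)
  then have ne: "?K \<noteq> {}" by force
  have cont: "continuous_on ?K (edge_form G :: _ \<Rightarrow> real)"
    unfolding edge_form_def
    by (intro continuous_intros continuous_on_subset[OF continuous_on_product_coordinates]) auto
  obtain y where y: "y \<in> ?K" and ymax: "\<And>z. z \<in> ?K \<Longrightarrow> edge_form G z \<le> edge_form G y"
    using continuous_attains_sup[OF comp ne cont] by blast
  have y1: "(\<Sum>j\<in>?V. y j ^ k) = 1" using y by simp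
  show thesis
  proof (rule that[of y "real k * edge_form G y"])
    show "y j \<ge> 0" for j using y by (auto split: if_splits dest!: spec[of _ j])
    show "\<exists>j\<in>?V. y j \<noteq> 0"
    proof (rule ccontr)
      assume "\<not> ?thesis"
      then have "(\<Sum>j\<in>?V. y j ^ k) = 0" using assms(2) by (intro sum.neutral) (auto simp: power_0_left)
      then show False using y1 by simp
    qed
    show "real k * edge_form G y = real k * edge_form G y * (\<Sum>j\<in>?V. y j ^ k)" using y1 by simp
    fix z :: "'a \<Rightarrow> real" assume z: "\<And>j. z j \<ge> 0"
    define S where "S = (\<Sum>j\<in>?V. z j ^ k)"
    have S0: "S \<ge> 0" unfolding S_def using z by (simp add: sum_nonneg)
    have "edge_form G z \<le> edge_form G y * S"
    proof (cases "S = 0")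
      \<comment> \<open>Such a vector cannot be normalised, but it vanishes on all vertices, and
        every edge is nonempty, so its edge form is 0.\<close>
      case True
      then have "\<forall>j\<in>?V. z j ^ k = 0" unfolding S_def
        using sum_nonneg_eq_0_iff[OF finV, of "\<lambda>j. z j ^ k"] z by simp
      then have z0: "\<forall>j\<in>?V. z j = 0" by simp
      have "edge_form G z = 0" unfolding edge_form_def
      proof (rule sum.neutral, rule ballI)
        fix e assume e: "e \<in> edges G"
        then have "card e = k" "e \<subseteq> ?V" using assms by (auto simp: uniform_def)
        moreover then obtain j where "j \<in> e" using assms(2) by (metis card.empty ex_in_conv not_numeral_le_zero)
        ultimately show "(\<Prod>j\<in>e. z j) = 0"
          using z0 uniform_finite_edge[OF assms(1) e] by (meson prod_zero subsetD)
      qed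
      then show ?thesis using True by simp
    next
      case False
      then have Spos: "S > 0" using S0 by simp
      define c where "c = root k S"
      have c: "c > 0" "c ^ k = S" using Spos assms(2) by (auto simp: c_def)
      \<comment> \<open>Dividing by the \<open>k\<close>-th root of \<open>S\<close> moves
        \<open>z\<close> onto the sphere. Setting the other coordinates to 0 puts \<open>w\<close>
        into \<open>?K\<close> without affecting the edge form.\<close>
      define w where "w = (\<lambda>j. if j \<in> ?V then z j / c else 0)"
      have w1: "(\<Sum>j\<in>?V. w j ^ k) = 1"
        using Spos by (simp add: w_def power_divide c sum_divide_distrib[symmetric] S_def[symmetric])
      have w0: "w j \<ge> 0" for j using z c by (simp add: w_def)
      have "w j \<le> 1" if "j \<in> ?V" for j
      proof -
        have "w j ^ k \<le> (\<Sum>j\<in>?V. w j ^ k)"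
          by (rule member_le_sum[OF that]) (use w0 finV in auto)
        then show ?thesis using w1 w0 assms(2) by (metis power_le_one_iff not_numeral_le_zero zero_less_iff_neq_zero order_less_le)
      qed
      moreover have "w j = 0" if "j \<notin> ?V" for j using that by (simp add: w_def)
      ultimately have "w \<in> ?K" using w0 w1 by simp
      then have "edge_form G w \<le> edge_form G y" by (rule ymax)
      moreover have "edge_form G z = S * edge_form G w"
      proof -
        have "edge_form G z = edge_form G (\<lambda>j. c * w j)"
          unfolding edge_form_def using assms(1) c
          by (intro sum.cong refl prod.cong) (auto simp: w_def uniform_def)
        then show ?thesis using edge_form_scale[OF assms(1)] c by metis
      qed
      ultimately show ?thesis using Spos by (simp add: mult.commute mult_left_mono)
    qed
    then show "real k * edge_form G z \<le> real k * edge_form G y * (\<Sum>j\<in>?V. z j ^ k)"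
      unfolding S_def by (simp add: mult.assoc mult_left_mono)
  qed
qed

text \<open>
  The edge form is affine in each single variable, so optimality of a maximizer can be exploited one
  coordinate at a time; it turns the maximizer into an eigenvector.
\<close>
lemma edge_form_le_eigenvalue:
  assumes "uniform k G" "k \<ge> 2" "verts G \<noteq> {}"
  obtains M where "tensor_eigenvalue (verts G) k (adjacency_tensor k G) (of_real M)"
    "\<And>z. (\<And>j. z j \<ge> 0) \<Longrightarrow> real k * edge_form G z \<le> M * (\<Sum>j\<in>verts G. z j ^ k)"
proof -
  have finV: "finite (verts G)" using assms by (auto simp: uniform_def)
  obtain y M where y: "\<And>j. y j \<ge> 0" "\<exists>j\<in>verts G. y j \<noteq> 0"
    "real k * edge_form G y = M * (\<Sum>j\<in>verts G. y j ^ k)"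
    and max: "\<And>z. (\<And>j. z j \<ge> 0) \<Longrightarrow> real k * edge_form G z \<le> M * (\<Sum>j\<in>verts G. z j ^ k)"
    using edge_form_maximizer[OF assms] by blast
  have deriv: "edge_form_deriv G y i = M * y i ^ (k - 1)" if i: "i \<in> verts G" for i
  proof (rule minimum_power_minus_linear[OF assms(2) y(1)])
    show "edge_form_deriv G y i \<ge> 0"
      unfolding edge_form_deriv_def using y(1) by (intro sum_nonneg prod_nonneg) auto
    fix t :: real assume t: "t \<ge> 0"
    \<comment> \<open>\<open>Q\<close> and \<open>R\<close> collect the terms free of the
      \<open>i\<close>-th coordinate; they cancel when the inequality at \<open>t\<close> is
      compared with the equality at \<open>y i\<close>.\<close>
    define Q where "Q = (\<Sum>e | e \<in> edges G \<and> i \<notin> e. \<Prod>j\<in>e. y j)"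
    define R where "R = (\<Sum>j\<in>verts G - {i}. y j ^ k)"
    have sum: "(\<Sum>j\<in>verts G. (y(i := u)) j ^ k) = u ^ k + R" for u
      unfolding R_def by (subst sum.remove[OF finV i]) (auto intro!: sum.cong)
    have "real k * edge_form G (y(i := t)) \<le> M * (t ^ k + R)"
      using max[of "y(i := t)"] y(1) t sum by auto
    moreover have "real k * edge_form G (y(i := y i)) = M * (y i ^ k + R)"
      using y(3) sum[of "y i"] by simp
    ultimately show "M * y i ^ k - real k * edge_form_deriv G y i * y i
        \<le> M * t ^ k - real k * edge_form_deriv G y i * t"
      unfolding edge_form_upd[OF assms(1)] Q_def[symmetric] by (simp add: algebra_simps)
  qed
  have "tensor_eigenvalue (verts G) k (adjacency_tensor k G) (of_real M)"
  proof (subst tensor_eigenvalue_adjacency[OF assms(1)], goal_cases)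
    case 2
    show ?case
    proof (intro exI conjI ballI)
      show "\<exists>i\<in>verts G. complex_of_real (y i) \<noteq> 0" using y(2) by simp
      fix i assume "i \<in> verts G"
      from deriv[OF this, THEN arg_cong[of _ _ complex_of_real]]
      show "edge_form_deriv G (\<lambda>i. complex_of_real (y i)) i = of_real M * of_real (y i) ^ (k - 1)"
        by (simp add: edge_form_deriv_def)
    qed
  qed (use assms in simp)
  with max that show thesis by blast
qed

text \<open>The constant of the maximization problem is itself a real eigenvalue, hence at most the
  spectral radius.\<close>

lemma edge_form_le_spectral_radius:
  assumes "uniform k G" "k \<ge> 2" and z: "\<And>j. z j \<ge> 0"
  shows "real k * edge_form G z \<le> spectral_radius k G * (\<Sum>j\<in>verts G. z j ^ k)"
proof (cases "verts G = {}")
  \<comment> \<open>Here there are no eigenvectors and the spectral radius is the \<open>Sup\<close>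
    of an empty set, but both sides of the inequality are 0.\<close>
  case True
  then have "edges G = {}" using assms by (force simp: uniform_def)
  then show ?thesis using True by (simp add: edge_form_def)
next
  case False
  obtain M where ev: "tensor_eigenvalue (verts G) k (adjacency_tensor k G) (of_real M)"
    and max: "\<And>z. (\<And>j. z j \<ge> 0) \<Longrightarrow> real k * edge_form G z \<le> M * (\<Sum>j\<in>verts G. z j ^ k)"
    using edge_form_le_eigenvalue[OF assms(1,2) False] by blast
  have "cmod (of_real M) \<le> spectral_radius k G"
    using eigenvalue_le_spectral_radius[OF assms(1) _ ev] assms(2) by simp
  then have "M \<le> spectral_radius k G" by simp
  moreover have "(\<Sum>j\<in>verts G. z j ^ k) \<ge> 0" using z by (simp add: sum_nonneg)
  ultimately show ?thesis using max[OF z] by (meson mult_right_mono order_trans)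
qed

section \<open>Neighbours, 2-sections and links\<close>

lemma neighbors_iff: "v \<in> neighbors H u \<longleftrightarrow> u \<noteq> v \<and> (\<exists>e\<in>edges H. u \<in> e \<and> v \<in> e)"
  unfolding neighbors_def graph_neighbors_def two_section_def
  by (auto simp: doubleton_eq_iff)

lemma neighbors_subset_verts: "uniform k H \<Longrightarrow> neighbors H u \<subseteq> verts H"
  by (fastforce simp: neighbors_iff uniform_def)

lemma uniform_two_section:
  assumes "uniform k H"
  shows "uniform 2 (two_section H)"
  using assms unfolding uniform_def two_section_def by fastforce

text \<open>Edges of the 2-section at \<open>i\<close> correspond to neighbours of \<open>i\<close>;
  the right-hand side is the adjacency matrix of the 2-section applied to \<open>y\<close>.\<close>

lemma edge_form_deriv_two_section:
  "edge_form_deriv (two_section H) y i = (\<Sum>j\<in>neighbors H i. y j)"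
proof -
  have inj: "inj_on (\<lambda>j. {i, j}) (neighbors H i)"
    by (auto simp: inj_on_def doubleton_eq_iff)
  have eq: "{e. e \<in> edges (two_section H) \<and> i \<in> e} = (\<lambda>j. {i, j}) ` neighbors H i"
    by (auto simp: two_section_def neighbors_iff image_iff doubleton_eq_iff) blast+
  have "{i, j} - {i} = {j}" if "j \<in> neighbors H i" for j
    using that by (auto simp: neighbors_iff)
  then have prod: "prod y ({i, j} - {i}) = y j" if "j \<in> neighbors H i" for j
    using that by (metis finite.emptyI prod.empty prod.insert empty_iff mult.right_neutral)
  show ?thesis
    unfolding edge_form_deriv_def eq
    by (subst sum.reindex[OF inj], unfold o_def) (intro sum.cong refl prod)
qed

text \<open>This is the bridge to the links: it turns the \<open>i\<close>-th eigenequation of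
  \<open>H\<close> into a statement about \<open>link H i\<close>, to which the variational bound
  applies.\<close>

lemma edge_form_link: "edge_form (link H i) y = edge_form_deriv H y i"
proof -
  have inj: "inj_on (\<lambda>e. e - {i}) {e. e \<in> edges H \<and> i \<in> e}"
    by (auto simp: inj_on_def)
  have eq: "edges (link H i) = (\<lambda>e. e - {i}) ` {e. e \<in> edges H \<and> i \<in> e}"
    by (auto simp: link_def)
  show ?thesis
    unfolding edge_form_deriv_def edge_form_def eq by (subst sum.reindex[OF inj]) simp
qed

section \<open>Isomorphism invariance and finiteness of the set of spectral radii\<close>

lemma edge_form_deriv_image:
  assumes "uniform k G" "inj_on f (verts G)" "i \<in> verts G"
  shows "edge_form_deriv (Hypergraph (f ` verts G) ((`) f ` edges G)) x (f i)
    = edge_form_deriv G (x \<circ> f) i"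
proof -
  have sub: "e \<subseteq> verts G" if "e \<in> edges G" for e using that assms by (auto simp: uniform_def)
  have mem: "f i \<in> f ` e \<longleftrightarrow> i \<in> e" if "e \<in> edges G" for e
    using inj_on_image_mem_iff[OF assms(2,3) sub[OF that]] .
  have inj: "inj_on ((`) f) {e. e \<in> edges G \<and> i \<in> e}"
    using inj_on_image_eq_iff[OF assms(2)] sub by (auto simp: inj_on_def)
  have eq: "{e. e \<in> (`) f ` edges G \<and> f i \<in> e} = (`) f ` {e. e \<in> edges G \<and> i \<in> e}"
    using mem by blast
  have "(\<Prod>j\<in>f ` e - {f i}. x j) = (\<Prod>j\<in>e - {i}. x (f j))" if e: "e \<in> edges G" "i \<in> e" for e
  proof -
    have "f ` e - {f i} = f ` (e - {i})"
      using e sub[OF e(1)] assms(2,3) by (auto simp: inj_on_def)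
    moreover have "inj_on f (e - {i})" using assms(2) sub[OF e(1)] by (auto simp: inj_on_def)
    ultimately show ?thesis by (simp add: prod.reindex)
  qed
  then show ?thesis
    unfolding edge_form_deriv_def by (simp add: eq sum.reindex[OF inj])
qed

lemma spectral_radius_image:
  assumes "uniform k G" "k \<ge> 1" "inj_on f (verts G)"
  shows "spectral_radius k (Hypergraph (f ` verts G) ((`) f ` edges G)) = spectral_radius k G"
proof -
  let ?G' = "Hypergraph (f ` verts G) ((`) f ` edges G)"
  have "card (f ` e) = k" if "e \<in> edges G" for e
    using that assms card_image[of f e] by (auto simp: uniform_def dest: inj_on_subset)
  then have unif: "uniform k ?G'"
    using assms(1) by (auto simp: uniform_def)
  have "tensor_eigenvalue (verts ?G') k (adjacency_tensor k ?G') l \<longleftrightarrow>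
      tensor_eigenvalue (verts G) k (adjacency_tensor k G) l" for l
  proof -
    have "tensor_eigenvalue (verts ?G') k (adjacency_tensor k ?G') l \<longleftrightarrow>
        (\<exists>x. (\<exists>i\<in>verts G. (x \<circ> f) i \<noteq> 0) \<and>
          (\<forall>i\<in>verts G. edge_form_deriv G (x \<circ> f) i = l * (x \<circ> f) i ^ (k - 1)))"
      unfolding tensor_eigenvalue_adjacency[OF unif assms(2)]
      by (simp add: edge_form_deriv_image[OF assms(1,3)] cong: ball_cong)
    also have "\<dots> \<longleftrightarrow> (\<exists>x. (\<exists>i\<in>verts G. x i \<noteq> 0) \<and>
        (\<forall>i\<in>verts G. edge_form_deriv G x i = l * x i ^ (k - 1)))" (is "?A \<longleftrightarrow> ?B")
    proof
      assume ?A then show ?B by blast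
    next
      assume ?B
      then obtain x where x: "\<exists>i\<in>verts G. x i \<noteq> 0"
        "\<forall>i\<in>verts G. edge_form_deriv G x i = l * x i ^ (k - 1)" by blast
      let ?x = "x \<circ> inv_into (verts G) f"
      have inv: "(?x \<circ> f) j = x j" if "j \<in> verts G" for j
        using that assms(3) by simp
      have "edge_form_deriv G (?x \<circ> f) i = edge_form_deriv G x i" for i
        unfolding edge_form_deriv_def
        by (intro sum.cong refl prod.cong inv) (use assms(1) in \<open>auto simp: uniform_def\<close>)
      then show ?A using x inv by (intro exI[of _ ?x]) simp
    qed
    finally show ?thesis unfolding tensor_eigenvalue_adjacency[OF assms(1,2)] .
  qed
  then show ?thesis by (simp add: spectral_radius_def tensor_spectral_radius_def)
qed

text \<open>Relabelling the vertices as \<open>{0..<n}\<close> preserves the spectral radius and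
  leaves finitely many possible edge sets. This makes the \<open>Max\<close> in \<open>spex\<close>
  meaningful for an arbitrary class of uniform hypergraphs.\<close>

lemma finite_spectral_radii:
  assumes "k \<ge> 1"
  shows "finite {spectral_radius k G | G :: 'a hypergraph. uniform k G \<and> card (verts G) = n}"
proof (rule finite_subset)
  show "{spectral_radius k G | G :: 'a hypergraph. uniform k G \<and> card (verts G) = n}
      \<subseteq> (\<lambda>E. spectral_radius k (Hypergraph {0..<n} E)) ` Pow (Pow {0..<n})"
  proof
    fix \<rho> assume "\<rho> \<in> {spectral_radius k G | G :: 'a hypergraph. uniform k G \<and> card (verts G) = n}"
    then obtain G :: "'a hypergraph" where G: "uniform k G" "card (verts G) = n"
      and \<rho>: "\<rho> = spectral_radius k G" by blast
    then have "finite (verts G)" by (simp add: uniform_def)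
    then obtain f where f: "bij_betw f (verts G) {0..<n}"
      using G(2) ex_bij_betw_finite_nat by blast
    have "(`) f ` edges G \<in> Pow (Pow {0..<n})"
      using f G(1) by (auto simp: bij_betw_def uniform_def)
    moreover have "\<rho> = spectral_radius k (Hypergraph {0..<n} ((`) f ` edges G))"
      unfolding \<rho> using spectral_radius_image[OF G(1) assms, of f] f by (simp add: bij_betw_def)
    ultimately show "\<rho> \<in> (\<lambda>E. spectral_radius k (Hypergraph {0..<n} E)) ` Pow (Pow {0..<n})"
      by blast
  qed
qed simp

lemma spectral_radius_le_spex:
  assumes "r \<ge> 1" "\<forall>G\<in>\<H>. uniform r G" "G \<in> \<H>" "card (verts G) = n" "\<not> contains G F"
  shows "spectral_radius r G \<le> spex r \<H> n F"
  unfolding spex_def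
proof (rule Max_ge)
  show "finite {spectral_radius r G | G. G \<in> \<H> \<and> card (verts G) = n \<and> \<not> contains G F}"
    by (rule finite_subset[OF _ finite_spectral_radii[OF assms(1), of n]]) (use assms(2) in blast)
qed (use assms in blast)

section \<open>Extremal bound for the links\<close>

text \<open>A copy of \<open>F\<close> in the link extends to a copy of the cone by sending
  \<open>None\<close> to \<open>i\<close> and putting \<open>i\<close> back into each edge.\<close>

lemma contains_cone:
  assumes "no_isolated F" "i \<in> verts H" "contains (add_isolated W (link H i)) F" "uniform k H"
  shows "contains H (cone F)"
proof -
  obtain H0 f where H0: "edges H0 \<subseteq> edges (link H i)"
    and f: "bij_betw f (verts F) (verts H0)" "(`) f ` edges F = edges H0"
    using assms(3) by (auto simp: contains_def isomorphic_def subhypergraph_def add_isolated_def)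
  \<comment> \<open>The copy avoids the padding vertices outside the link: each of its vertices lies
    in the image of an edge of \<open>F\<close>, and hence in an edge of the link.\<close>
  have nb: "v \<in> neighbors H i" if v: "v \<in> verts H0" for v
  proof -
    obtain u where u: "u \<in> verts F" "v = f u" using v bij_betw_imp_surj_on[OF f(1)] by blast
    obtain e where e: "e \<in> edges F" "u \<in> e" using assms(1) u by (auto simp: no_isolated_def)
    have "f ` e \<in> edges (link H i)" using f e H0 by blast
    then obtain e' where "e' \<in> edges H" "i \<in> e'" "f ` e = e' - {i}" by (auto simp: link_def)
    then show ?thesis using e u by (auto simp: neighbors_iff)
  qed
  have iH0: "i \<notin> verts H0" using nb neighbors_iff by fast
  let ?g = "case_option i f"
  let ?H1 = "Hypergraph (insert i (verts H0)) (insert i ` edges H0)"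
  have "isomorphic (cone F) ?H1"
    unfolding isomorphic_def
  proof (intro exI conjI)
    show "bij_betw ?g (verts (cone F)) (verts ?H1)"
      using f(1) iH0 by (auto simp: cone_def bij_betw_def inj_on_def image_image)
    have "?g ` insert None (Some ` e) = insert i (f ` e)" for e by (auto simp: image_image)
    then show "(\<lambda>e. ?g ` e) ` edges (cone F) = edges ?H1"
      by (simp add: cone_def image_image f(2)[symmetric])
  qed
  moreover have "subhypergraph ?H1 H"
    unfolding subhypergraph_def
  proof
    show "verts ?H1 \<subseteq> verts H"
      using nb assms(2) neighbors_subset_verts[OF assms(4)] by auto
    have "insert i e \<in> edges H" if e: "e \<in> edges H0" for e
    proof -
      obtain e' where "e' \<in> edges H" "i \<in> e'" "e = e' - {i}"
        using e H0 by (auto simp: link_def)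
      then show ?thesis by (simp add: insert_absorb)
    qed
    then show "edges ?H1 \<subseteq> edges H" by auto
  qed
  ultimately show ?thesis by (auto simp: contains_def)
qed

text \<open>The padding by \<open>W\<close> brings the link to exactly \<open>n\<close> vertices, so
  that its spectral radius competes in \<open>spex\<close> at \<open>n\<close>; the edges, and with
  them the edge form, stay the same.\<close>

lemma edge_form_link_le_spex:
  assumes "r \<ge> 2" "\<forall>G\<in>\<H>. uniform r G" "card (verts (add_isolated W (link H i))) = n"
    "add_isolated W (link H i) \<in> \<H>" "\<not> contains (add_isolated W (link H i)) F" "n > 0"
    and y: "\<And>j. y j \<ge> 0"
  shows "spex r \<H> n F \<ge> 0"
    and "real r * edge_form (link H i) y \<le> spex r \<H> n F * (\<Sum>j\<in>neighbors H i. y j ^ r)"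
proof -
  let ?G = "add_isolated W (link H i)"
  have unif: "uniform r ?G" using assms by blast
  have le: "spectral_radius r ?G \<le> spex r \<H> n F"
    using assms by (intro spectral_radius_le_spex) auto
  have fin: "finite (verts ?G)" using unif by (simp add: uniform_def)
  \<comment> \<open>Testing with the all-ones vector shows that the spectral radius is nonnegative,
    since there are \<open>n > 0\<close> vertices.\<close>
  have "0 \<le> real r * edge_form ?G (\<lambda>_. 1)" by (simp add: edge_form_def)
  also have "\<dots> \<le> spectral_radius r ?G * (\<Sum>j\<in>verts ?G. 1 ^ r)"
    by (rule edge_form_le_spectral_radius[OF unif assms(1)]) simp
  finally have "0 \<le> spectral_radius r ?G"
    using assms(3,6) by (simp add: zero_le_mult_iff)
  then show "spex r \<H> n F \<ge> 0" using le by simp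
  \<comment> \<open>Truncation removes the padding vertices from the power sum and does not change
    the edge form, as every edge of the link consists of neighbours of \<open>i\<close>.\<close>
  let ?z = "\<lambda>j. if j \<in> neighbors H i then y j else 0"
  have "edge_form ?G ?z = edge_form (link H i) y"
    unfolding edge_form_def add_isolated_def
    by (intro sum.cong prod.cong) (auto simp: link_def neighbors_iff)
  then have "real r * edge_form (link H i) y = real r * edge_form ?G ?z" by simp
  also have "\<dots> \<le> spectral_radius r ?G * (\<Sum>j\<in>verts ?G. ?z j ^ r)"
    by (rule edge_form_le_spectral_radius[OF unif assms(1)]) (simp add: y)
  also have "(\<Sum>j\<in>verts ?G. ?z j ^ r) = (\<Sum>j\<in>neighbors H i. y j ^ r)"
    using assms(1) fin
    by (intro sum.mono_neutral_cong_right) (auto simp: add_isolated_def link_def)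
  also have "spectral_radius r ?G * (\<Sum>j\<in>neighbors H i. y j ^ r)
      \<le> spex r \<H> n F * (\<Sum>j\<in>neighbors H i. y j ^ r)"
    using le y by (intro mult_right_mono sum_nonneg) auto
  finally show "real r * edge_form (link H i) y \<le> spex r \<H> n F * (\<Sum>j\<in>neighbors H i. y j ^ r)" .
qed

section \<open>Spectral estimates and the theorem\<close>

text \<open>The Rayleigh bound for the adjacency matrix: the variational bound with exponent 2,
  where Euler's identity rewrites twice the edge form as the quadratic form.\<close>

lemma quadratic_form_two_section_le:
  assumes "uniform k H" "\<And>j. y j \<ge> 0"
  shows "(\<Sum>i\<in>verts H. y i * (\<Sum>j\<in>neighbors H i. y j))
    \<le> spectral_radius 2 (two_section H) * (\<Sum>i\<in>verts H. y i ^ 2)"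
proof -
  have v: "verts (two_section H) = verts H" by (simp add: two_section_def)
  show ?thesis
    using edge_form_le_spectral_radius[OF uniform_two_section[OF assms(1)] _ assms(2)]
      euler_identity[OF uniform_two_section[OF assms(1)], of y]
    by (simp add: v edge_form_deriv_two_section)
qed

text \<open>The variational bound at the all-ones vector; the left-hand side is the sum of the
  vertex degrees.\<close>

lemma average_degree_le_spectral_radius:
  assumes "uniform k H" "k \<ge> 2"
  shows "real k * real (card (edges H)) \<le> spectral_radius k H * real (card (verts H))"
  using edge_form_le_spectral_radius[OF assms, of "\<lambda>_. 1"] by (simp add: edge_form_def)

lemma spectral_radius_leI:
  assumes "uniform k H" "k \<ge> 2" "verts H \<noteq> {}"
    and le: "\<And>x l. \<exists>i\<in>verts H. x i \<noteq> 0 \<Longrightarrow>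
      \<forall>i\<in>verts H. edge_form_deriv H x i = l * x i ^ (k - 1) \<Longrightarrow> cmod l \<le> B"
  shows "spectral_radius k H \<le> B"
proof -
  have ev: "tensor_eigenvalue (verts H) k (adjacency_tensor k H) l \<longleftrightarrow>
    (\<exists>x. (\<exists>i\<in>verts H. x i \<noteq> 0) \<and> (\<forall>i\<in>verts H. edge_form_deriv H x i = l * x i ^ (k - 1)))" for l
    using assms by (intro tensor_eigenvalue_adjacency) auto
  \<comment> \<open>Bounding a \<open>Sup\<close> by bounding each element requires a nonempty set;
    the maximizer of the edge form supplies an eigenvalue.\<close>
  have "{l. tensor_eigenvalue (verts H) k (adjacency_tensor k H) l} \<noteq> {}"
    using edge_form_le_eigenvalue[OF assms(1-3)] by blast
  then show ?thesis
    unfolding spectral_radius_def tensor_spectral_radius_def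
    by (intro cSup_least) (use ev le in \<open>blast+\<close>)
qed

theorem theorem3p2:
  fixes r :: nat
    and H :: "'a hypergraph"
    and \<H> :: "'a hypergraph set"
    and F :: "'b hypergraph"
  assumes "r \<ge> 2"
    and "uniform (r + 1) H"
    and "edges H \<noteq> {}"
    and "\<forall>G\<in>\<H>. uniform r G"
    and "\<forall>i\<in>verts H. link H i \<in> \<H>"
    and "\<forall>i\<in>verts H. \<exists>W. card (verts (add_isolated W (link H i))) = (MAX j\<in>verts H. card (neighbors H j))
           \<and> add_isolated W (link H i) \<in> \<H>"
    and "uniform r F"
    and "no_isolated F"
    and "spectral_radius_ratio (r + 1) H
           > 1 / real r * spex r \<H> (MAX i\<in>verts H. card (neighbors H i)) F
         \<or> real (r + 1) * real (card (edges H))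
           > 1 / real r * real (card (verts H)) * spectral_radius 2 (two_section H)
               * spex r \<H> (MAX i\<in>verts H. card (neighbors H i)) F
         \<or> spectral_radius (r + 1) H
           > 1 / real r * real (max_degree (two_section H))
               * spex r \<H> (MAX i\<in>verts H. card (neighbors H i)) F"
  shows "contains H (cone F)"
proof (rule ccontr)
  assume nc: "\<not> contains H (cone F)"
  define n where "n = (MAX i\<in>verts H. card (neighbors H i))"
  define s where "s = spex r \<H> n F"
  define \<rho>\<^sub>2 where "\<rho>\<^sub>2 = spectral_radius 2 (two_section H)"
  note unif = \<open>uniform (r + 1) H\<close>
  have finV: "finite (verts H)" using unif by (simp add: uniform_def)
  obtain e where e: "e \<in> edges H" using assms(3) by blast
  then have e': "e \<subseteq> verts H" "card e = r + 1" using unif by (auto simp: uniform_def)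
  then obtain u where u: "u \<in> e" by fastforce
  \<comment> \<open>A second vertex in an edge gives \<open>u\<close> a neighbour. This yields
    \<open>n > 0\<close> and, further below, a positive degree sum.\<close>
  have "e \<noteq> {u}" using e'(2) assms(1) by auto
  then obtain w where w: "w \<in> e" "w \<noteq> u" using u by blast
  have uV: "u \<in> verts H" using u e' by blast
  then have V: "verts H \<noteq> {}" "card (verts H) > 0" using finV by (auto simp: card_gt_0_iff)
  have finN: "finite (neighbors H i)" for i
    using neighbors_subset_verts[OF unif] finV by (rule finite_subset)
  have wN: "w \<in> neighbors H u" using u w e by (auto simp: neighbors_iff)
  have "0 < card (neighbors H u)" using wN finN by (auto simp: card_gt_0_iff)
  also have "\<dots> \<le> n" unfolding n_def using finV uV by (intro Max_ge) auto
  finally have n: "n > 0" .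
  have link: "s \<ge> 0"
    "real r * edge_form_deriv H y i \<le> s * (\<Sum>j\<in>neighbors H i. y j ^ r)"
    if i: "i \<in> verts H" and y: "\<And>j. y j \<ge> 0" for y i
  proof -
    obtain W where W: "card (verts (add_isolated W (link H i))) = n"
      "add_isolated W (link H i) \<in> \<H>"
      using assms(6) i unfolding n_def by blast
    have "\<not> contains (add_isolated W (link H i)) F"
      using contains_cone[OF assms(8) i _ unif] nc by blast
    from edge_form_link_le_spex[OF assms(1,4) W this n y]
    show "s \<ge> 0" "real r * edge_form_deriv H y i \<le> s * (\<Sum>j\<in>neighbors H i. y j ^ r)"
      by (simp_all add: s_def edge_form_link)
  qed
  have s0: "s \<ge> 0" using link(1)[OF uV, of "\<lambda>_. 0"] by simp
  have eigen: "real r * cmod l * cmod (x i) ^ r \<le> s * (\<Sum>j\<in>neighbors H i. cmod (x j) ^ r)"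
    if "\<forall>i\<in>verts H. edge_form_deriv H x i = l * x i ^ (r + 1 - 1)" "i \<in> verts H" for x l i
  proof -
    have "cmod l * cmod (x i) ^ r \<le> edge_form_deriv H (\<lambda>j. cmod (x j)) i"
      using that by (intro cmod_eigenvector_inequality) auto
    then have "real r * (cmod l * cmod (x i) ^ r) \<le> real r * edge_form_deriv H (\<lambda>j. cmod (x j)) i"
      by (intro mult_left_mono) auto
    also have "\<dots> \<le> s * (\<Sum>j\<in>neighbors H i. cmod (x j) ^ r)"
      using link(2)[OF that(2), of "\<lambda>j. cmod (x j)"] by simp
    finally show ?thesis by (simp add: mult.assoc)
  qed
  have ratio: "spectral_radius (r + 1) H \<le> s / real r * \<rho>\<^sub>2"
  proof (rule spectral_radius_leI[OF unif _ V(1)])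
    fix x :: "'a \<Rightarrow> complex" and l assume x: "\<exists>i\<in>verts H. x i \<noteq> 0"
      and ev: "\<forall>i\<in>verts H. edge_form_deriv H x i = l * x i ^ (r + 1 - 1)"
    define z where "z = (\<lambda>i. cmod (x i) ^ r)"
    have z0: "z i \<ge> 0" for i by (simp add: z_def)
    obtain i where i: "i \<in> verts H" "x i \<noteq> 0" using x by blast
    have pos: "(\<Sum>i\<in>verts H. z i ^ 2) > 0"
      using i finV by (intro sum_pos2[of _ i]) (auto simp: z_def)
    have "real r * cmod l * (\<Sum>i\<in>verts H. z i ^ 2) = (\<Sum>i\<in>verts H. z i * (real r * cmod l * z i))"
      by (simp add: sum_distrib_left power2_eq_square algebra_simps)
    also have "\<dots> \<le> (\<Sum>i\<in>verts H. z i * (s * (\<Sum>j\<in>neighbors H i. z j)))"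
      using eigen[OF ev] z0 unfolding z_def by (intro sum_mono mult_left_mono) auto
    also have "\<dots> = s * (\<Sum>i\<in>verts H. z i * (\<Sum>j\<in>neighbors H i. z j))"
      by (simp add: sum_distrib_left algebra_simps)
    also have "\<dots> \<le> s * (\<rho>\<^sub>2 * (\<Sum>i\<in>verts H. z i ^ 2))"
      unfolding \<rho>\<^sub>2_def using quadratic_form_two_section_le[OF unif z0] s0 by (intro mult_left_mono) auto
    finally have "(real r * cmod l) * (\<Sum>i\<in>verts H. z i ^ 2) \<le> (s * \<rho>\<^sub>2) * (\<Sum>i\<in>verts H. z i ^ 2)"
      by (simp add: mult.assoc)
    then have "real r * cmod l \<le> s * \<rho>\<^sub>2" using pos by simp
    then show "cmod l \<le> s / real r * \<rho>\<^sub>2" using assms(1) by (simp add: field_simps)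
  qed (use assms(1) in simp)
  have degree: "spectral_radius (r + 1) H \<le> s / real r * real (max_degree (two_section H))"
  proof (rule spectral_radius_leI[OF unif _ V(1)])
    fix x :: "'a \<Rightarrow> complex" and l assume x: "\<exists>i\<in>verts H. x i \<noteq> 0"
      and ev: "\<forall>i\<in>verts H. edge_form_deriv H x i = l * x i ^ (r + 1 - 1)"
    obtain m where m: "m \<in> verts H" "cmod (x m) > 0"
      "\<And>j. j \<in> verts H \<Longrightarrow> cmod (x j) \<le> cmod (x m)"
      using maximal_coordinate[of "verts H" "\<lambda>j. cmod (x j)"] x finV by auto
    have card: "card (neighbors H m) \<le> max_degree (two_section H)"
      unfolding max_degree_def neighbors_def using finV m(1)
      by (intro Max_ge) (auto simp: two_section_def)
    \<comment> \<open>At the largest coordinate the neighbour sum is at most the degree times that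
      coordinate, whose positive power is then cancelled.\<close>
    have "(\<Sum>j\<in>neighbors H m. cmod (x j) ^ r) \<le> (\<Sum>j\<in>neighbors H m. cmod (x m) ^ r)"
      using neighbors_subset_verts[OF unif] m(3) by (intro sum_mono power_mono) auto
    also have "\<dots> \<le> real (max_degree (two_section H)) * cmod (x m) ^ r"
      using card by (simp add: mult_right_mono)
    finally have "s * (\<Sum>j\<in>neighbors H m. cmod (x j) ^ r)
        \<le> s * (real (max_degree (two_section H)) * cmod (x m) ^ r)"
      using s0 by (rule mult_left_mono)
    with eigen[OF ev m(1)] have "(real r * cmod l) * cmod (x m) ^ r
        \<le> (s * real (max_degree (two_section H))) * cmod (x m) ^ r"
      by (simp add: mult.assoc)
    then have "real r * cmod l \<le> s * real (max_degree (two_section H))"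
      using m(2) by simp
    then show "cmod l \<le> s / real r * real (max_degree (two_section H))"
      using assms(1) by (simp add: field_simps)
  qed (use assms(1) in simp)
  \<comment> \<open>The all-ones vector in the Rayleigh bound, with a positive degree sum, forces
    \<open>\<rho>\<^sub>2 > 0\<close>; this allows dividing by it in the spectral radius
    ratio.\<close>
  have "(\<Sum>i\<in>verts H. real (card (neighbors H i))) \<le> \<rho>\<^sub>2 * real (card (verts H))"
    using quadratic_form_two_section_le[OF unif, of "\<lambda>_. 1"] by (simp add: \<rho>\<^sub>2_def)
  moreover have "(\<Sum>i\<in>verts H. real (card (neighbors H i))) > 0"
    using wN finN uV finV by (intro sum_pos2[of _ u]) (auto simp: card_gt_0_iff)
  ultimately have "\<rho>\<^sub>2 * real (card (verts H)) > 0" by linarith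
  then have \<rho>\<^sub>2: "\<rho>\<^sub>2 > 0" using V(2) by (simp add: zero_less_mult_iff)
  have c1: "spectral_radius_ratio (r + 1) H \<le> 1 / real r * s"
    using ratio \<rho>\<^sub>2 by (simp add: spectral_radius_ratio_def \<rho>\<^sub>2_def[symmetric] pos_divide_le_eq)
  have "real (r + 1) * real (card (edges H)) \<le> spectral_radius (r + 1) H * real (card (verts H))"
    by (rule average_degree_le_spectral_radius[OF unif]) (use assms(1) in simp)
  also have "\<dots> \<le> s / real r * \<rho>\<^sub>2 * real (card (verts H))"
    using ratio by (intro mult_right_mono) auto
  finally have c2: "real (r + 1) * real (card (edges H)) \<le> 1 / real r * real (card (verts H)) * \<rho>\<^sub>2 * s"
    by (simp add: algebra_simps)
  have c3: "spectral_radius (r + 1) H \<le> 1 / real r * real (max_degree (two_section H)) * s"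
    using degree by (simp add: algebra_simps)
  show False
    using assms(9) c1 c2 c3 unfolding n_def[symmetric] s_def[symmetric] \<rho>\<^sub>2_def[symmetric]
    by linarith
qed

end
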